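(* Let $(\bm X, Y)$ be an input text with its label, let $h, s, c$ be real constants, and let $\lambda_g, \lambda_s, \lambda_c \ge 0$ be weights. Let $\bm z(\cdot)$ be a rationalization scheme, with $\bm R = \bm r(\bm X)$, $\bm R^c = \bm r^c(\bm X)$, $\bm Z = \bm z(\bm X)$, that simultaneously satisfies (Sufficiency) $p_Y(\cdot \mid \bm R) = p_Y(\cdot \mid \bm X)$ almost surely; (Comprehensiveness) $H(Y \mid \bm R^c) \ge H(Y \mid \bm R) + h$; (Compactness) $\sum_{i} \bm Z_i \le s$ and $\sum_{i} |\bm Z_i - \bm Z_{i-1}| \le c$ almost surely. Then $\bm z(\cdot)$ is a global minimizer, over all rationalization schemes, of the generator objective $$\mathcal{L}_p + \lambda_g \mathcal{L}_g + \lambda_s \mathcal{L}_s + \lambda_c \mathcal{L}_{\mathrm{cont}}.$$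
   Context: Setting. $\bm X = (\bm X_1,\dots,\bm X_L)$ is a random sequence of $L$ words (each word is represented by a vector, taking finitely many values) and $Y$ is a random label in a finite set; $(\bm X, Y)$ has a fixed joint distribution. $p_Y(\cdot\mid \cdot)$ denotes conditional probability mass functions of $Y$, and $H(Y\mid\cdot)$ denotes conditional Shannon entropy. Rationalization scheme. A function $\bm z$ assigning to each text $\bm x = (\bm x_1,\dots,\bm x_L)$ a binary mask $\bm z(\bm x) = (\bm z_1(\bm x),\dots,\bm z_L(\bm x)) \in \{0,1\}^L$. The rationale $\bm r(\bm x)$ and its complement $\bm r^c(\bm x)$ are the sequences with entries $\bm r_i(\bm x) = \bm z_i(\bm x)\cdot \bm x_i$ and $\bm r_i^c(\bm x) = (1-\bm z_i(\bm x))\cdot \bm x_i$. Write $\bm R = \bm r(\bm X)$, $\bm R^c = \bm r^c(\bm X)$, $\bm Z = \bm z(\bm X)$. Losses (all are functions of the scheme $\bm z$). - Predictor loss: $\mathcal{L}_p = \min_{\hat p} \mathbb{E}[-\log \hat p(Y\mid \bm R)]$, the minimum over all conditional probability mass functions $\hat p(\cdot\mid\cdot)$ of a label given a masked text (values in $[0,\infty]$ allowed for the cross entropy). - Complement predictor loss: $\mathcal{L}_{\mathrm{comp}} = \min_{\hat p^c} \mathbb{E}[-\log \hat p^c(Y\mid \bm R^c)]$, likewise. - Gap loss: $\mathcal{L}_g = \max\{\mathcal{L}_p - \mathcal{L}_{\mathrm{comp}} + h, 0\}$. - Sparsity loss: $\mathcal{L}_s = \mathbb{E}\big[\max\{\sum_{i=1}^L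 \bm Z_i - s, 0\}\big]$. - Continuity loss: $\mathcal{L}_{\mathrm{cont}} = \mathbb{E}\big[\sum_i \max\{|\bm Z_i - \bm Z_{i-1}| - c, 0\}\big]$. Sums involving $\bm Z_i-\bm Z_{i-1}$ run over $i = 2,\dots,L$. *)

theory Defs
  imports "HOL-Probability.Probability"
begin

text \<open>
  A text of \<open>L\<close> words is a function on the positions \<open>1, \<dots>, L\<close>, extended by
  \<^const>\<open>undefined\<close> outside of them, so that equality of texts is equality of word sequences.
  Masks are represented in the same way, with real entries so that they can scale word vectors.
\<close>

definition texts :: "nat \<Rightarrow> (nat \<Rightarrow> 'v::euclidean_space) set" where
  "texts L = {1..L} \<rightarrow>\<^sub>E UNIV"

definition masks :: "nat \<Rightarrow> (nat \<Rightarrow> real) set" where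
  "masks L = {1..L} \<rightarrow>\<^sub>E {0, 1}"

definition schemes :: "nat \<Rightarrow> ((nat \<Rightarrow> 'v::euclidean_space) \<Rightarrow> (nat \<Rightarrow> real)) set" where
  "schemes L = texts L \<rightarrow> masks L"

definition rationale ::
  "nat \<Rightarrow> ((nat \<Rightarrow> 'v::euclidean_space) \<Rightarrow> (nat \<Rightarrow> real)) \<Rightarrow> (nat \<Rightarrow> 'v) \<Rightarrow> (nat \<Rightarrow> 'v)" where
  "rationale L z x = (\<lambda>i\<in>{1..L}. z x i *\<^sub>R x i)"

definition complement_rationale ::
  "nat \<Rightarrow> ((nat \<Rightarrow> 'v::euclidean_space) \<Rightarrow> (nat \<Rightarrow> real)) \<Rightarrow> (nat \<Rightarrow> 'v) \<Rightarrow> (nat \<Rightarrow> 'v)" where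
  "complement_rationale L z x = (\<lambda>i\<in>{1..L}. (1 - z x i) *\<^sub>R x i)"

text \<open>
  The case distinction is needed because \<open>log b 0 = 0\<close> in the library. For \<open>b > 1\<close> and
  probabilities \<open>p\<close> the value \<open>- log b p\<close> is nonnegative, so \<^const>\<open>ennreal\<close> does not truncate.
\<close>

definition neg_log :: "real \<Rightarrow> real \<Rightarrow> ennreal" where
  "neg_log b p = (if p = 0 then \<infinity> else ennreal (- log b p))"

definition cross_entropy ::
  "'w measure \<Rightarrow> real \<Rightarrow> ('w \<Rightarrow> 't) \<Rightarrow> ('w \<Rightarrow> 'y) \<Rightarrow> ('t \<Rightarrow> 'y pmf) \<Rightarrow> ennreal" where
  "cross_entropy M b T Y q = (\<integral>\<^sup>+ \<omega>. neg_log b (pmf (q (T \<omega>)) (Y \<omega>)) \<partial>M)"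

text \<open>
  The minimal cross entropy of a predictor of \<open>Y\<close> that observes \<open>T\<close>. For a finite label type it
  is finite (see \<open>min_cross_entropy_finite\<close> below), so the conversion to a real number loses
  nothing.
\<close>

definition min_cross_entropy ::
  "'w measure \<Rightarrow> real \<Rightarrow> ('w \<Rightarrow> 't) \<Rightarrow> ('w \<Rightarrow> 'y) \<Rightarrow> real" where
  "min_cross_entropy M b T Y = enn2real (INF q. cross_entropy M b T Y q)"

lemma min_cross_entropy_finite:
  fixes Y :: "'w \<Rightarrow> 'y::finite"
  assumes "prob_space M"
  shows "(INF q. cross_entropy M b T Y q) < \<infinity>"
proof -
  interpret prob_space M by fact
  have "cross_entropy M b T Y (\<lambda>_. pmf_of_set UNIV) = ennreal (- log b (1 / CARD('y)))"
    by (simp add: cross_entropy_def neg_log_def emeasure_space_1)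
  then have "cross_entropy M b T Y (\<lambda>_. pmf_of_set UNIV) < \<infinity>"
    by simp
  then show ?thesis
    by (auto simp: INF_less_iff)
qed

definition predictor_loss where
  "predictor_loss M b L X Y z = min_cross_entropy M b (\<lambda>\<omega>. rationale L z (X \<omega>)) Y"

definition complement_loss where
  "complement_loss M b L X Y z = min_cross_entropy M b (\<lambda>\<omega>. complement_rationale L z (X \<omega>)) Y"

definition gap_loss where
  "gap_loss M b L X Y h z = max (predictor_loss M b L X Y z - complement_loss M b L X Y z + h) 0"

definition sparsity_loss ::
  "'w measure \<Rightarrow> nat \<Rightarrow> ('w \<Rightarrow> 't) \<Rightarrow> real \<Rightarrow> ('t \<Rightarrow> nat \<Rightarrow> real) \<Rightarrow> real" where
  "sparsity_loss M L X s z = (\<integral>\<omega>. max ((\<Sum>i=1..L. z (X \<omega>) i) - s) 0 \<partial>M)"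

definition continuity_loss ::
  "'w measure \<Rightarrow> nat \<Rightarrow> ('w \<Rightarrow> 't) \<Rightarrow> real \<Rightarrow> ('t \<Rightarrow> nat \<Rightarrow> real) \<Rightarrow> real" where
  "continuity_loss M L X c z =
     (\<integral>\<omega>. (\<Sum>i=2..L. max (\<bar>z (X \<omega>) i - z (X \<omega>) (i - 1)\<bar> - c) 0) \<partial>M)"

definition generator_objective ::
  "'w measure \<Rightarrow> real \<Rightarrow> nat \<Rightarrow> ('w \<Rightarrow> nat \<Rightarrow> 'v::euclidean_space) \<Rightarrow> ('w \<Rightarrow> 'y)
    \<Rightarrow> real \<Rightarrow> real \<Rightarrow> real \<Rightarrow> real \<Rightarrow> real \<Rightarrow> real
    \<Rightarrow> ((nat \<Rightarrow> 'v) \<Rightarrow> nat \<Rightarrow> real) \<Rightarrow> real" where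
  "generator_objective M b L X Y h s c lg ls lc z =
     predictor_loss M b L X Y z + lg * gap_loss M b L X Y h z
       + ls * sparsity_loss M L X s z + lc * continuity_loss M L X c z"

text \<open>
  Conditional Shannon entropy \<open>H(Y | T)\<close> to base \<open>b\<close> of random variables with finitely many
  values, as in the notation of the library locale \<^locale>\<open>information_space\<close>.
\<close>

abbreviation cond_entropy ::
  "'w measure \<Rightarrow> real \<Rightarrow> ('w \<Rightarrow> 'y) \<Rightarrow> ('w \<Rightarrow> 't) \<Rightarrow> real" where
  "cond_entropy M b Y T \<equiv> prob_space.conditional_entropy M b
     (count_space (Y ` space M)) (count_space (T ` space M)) Y T"

end

theory Submission
  imports Defs
begin

text \<open>
  By Gibbs' inequality the minimal cross entropy of a predictor observing \<open>T\<close> is attained at the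
  conditional distribution of \<open>Y\<close> given \<open>T\<close>, and its value is \<open>H(Y | T)\<close>. A rationale is a
  function of the text, so no scheme has a predictor loss below the minimal cross entropy of a
  predictor that sees all of \<open>X\<close>; sufficiency says that \<open>z\<close> attains this bound.
  Comprehensiveness and compactness make the other, nonnegative losses of \<open>z\<close> vanish.
\<close>

section \<open>Conditional distribution of the label given an observation\<close>

text \<open>If \<open>T = t\<close> has probability zero, the conditional probabilities are 0 by
  division by zero and do not form a pmf; the uniform pmf is the default there. Such observations
  form a null event by \<open>AE_simple_function_prob_nonzero\<close>.\<close>

definition bayes_predictor ::
  "'w measure \<Rightarrow> ('w \<Rightarrow> 't) \<Rightarrow> ('w \<Rightarrow> 'y::finite) \<Rightarrow> 't \<Rightarrow> 'y pmf" where
  "bayes_predictor M T Y t =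
     (if \<P>(\<omega> in M. T \<omega> = t) = 0 then pmf_of_set UNIV
      else embed_pmf (\<lambda>y. \<P>(\<omega> in M. Y \<omega> = y \<bar> T \<omega> = t)))"

lemma sets_simple_function_eq:
  assumes "simple_function M f"
  shows "{\<omega> \<in> space M. f \<omega> = a} \<in> sets M"
  using simple_functionD(2)[OF assms, of "{a}"] by (simp add: vimage_def Int_def conj_commute)

context prob_space
begin

text \<open>\<open>T\<close> has finitely many values, so the union of its null level sets is null.
  Applied to a pair, this says that the joint probability of the observed values is almost surely
  nonzero.\<close>

lemma AE_simple_function_prob_nonzero:
  assumes T: "simple_function M T"
  shows "AE \<omega> in M. \<P>(\<omega>' in M. T \<omega>' = T \<omega>) \<noteq> 0"
proof -
  have "AE \<omega> in M. T \<omega> \<noteq> t" if "\<P>(\<omega>' in M. T \<omega>' = t) = 0" for t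
    using that sets_simple_function_eq[OF T, of t]
    by (subst AE_iff_measurable[OF _ refl]) (auto simp: emeasure_eq_measure)
  then have "AE \<omega> in M. \<forall>t\<in>T ` space M. \<P>(\<omega>' in M. T \<omega>' = t) = 0 \<longrightarrow> T \<omega> \<noteq> t"
    using simple_functionD(1)[OF T]
    by (intro AE_ball_countable') (auto simp: countable_finite)
  with AE_space show ?thesis
    by eventually_elim auto
qed

lemma sum_prob_simple_function_eq:
  fixes Y :: "'a \<Rightarrow> 'y::finite"
  assumes T: "simple_function M T" and Y: "simple_function M Y"
  shows "(\<Sum>y\<in>UNIV. \<P>(\<omega> in M. Y \<omega> = y \<and> T \<omega> = t)) = \<P>(\<omega> in M. T \<omega> = t)"
proof -
  have meas: "{\<omega> \<in> space M. Y \<omega> = y \<and> T \<omega> = t} \<in> sets M" for y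
    using sets_simple_function_eq[OF T, of t] sets_simple_function_eq[OF Y, of y] by measurable
  have "(\<Sum>y\<in>UNIV. \<P>(\<omega> in M. Y \<omega> = y \<and> T \<omega> = t)) =
      prob (\<Union>y. {\<omega> \<in> space M. Y \<omega> = y \<and> T \<omega> = t})"
    using meas by (intro finite_measure_finite_Union[symmetric]) (auto simp: disjoint_family_on_def)
  also have "(\<Union>y. {\<omega> \<in> space M. Y \<omega> = y \<and> T \<omega> = t}) = {\<omega> \<in> space M. T \<omega> = t}"
    by auto
  finally show ?thesis .
qed

lemma pmf_bayes_predictor:
  fixes Y :: "'a \<Rightarrow> 'y::finite"
  assumes T: "simple_function M T" and Y: "simple_function M Y"
    and pos: "\<P>(\<omega> in M. T \<omega> = t) \<noteq> 0"
  shows "pmf (bayes_predictor M T Y t) y = \<P>(\<omega> in M. Y \<omega> = y \<bar> T \<omega> = t)"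
proof -
  have "(\<Sum>y\<in>UNIV. \<P>(\<omega> in M. Y \<omega> = y \<bar> T \<omega> = t)) = 1"
    using sum_prob_simple_function_eq[OF T Y, of t] pos
    by (simp add: cond_prob_def flip: sum_divide_distrib)
  then have "(\<integral>\<^sup>+ y. ennreal \<P>(\<omega> in M. Y \<omega> = y \<bar> T \<omega> = t) \<partial>count_space UNIV) = 1"
    by (simp add: nn_integral_count_space_finite cond_prob_def)
  with pos show ?thesis
    by (simp add: bayes_predictor_def) (subst pmf_embed_pmf, auto simp: cond_prob_def)
qed

text \<open>Turns expectations into finite sums over attained pairs. Values in
  \<open>ennreal\<close> admit \<open>neg_log\<close>, which can be infinite; the order
  \<open>(y, t)\<close> matches the library formula for conditional entropy.\<close>

lemma nn_integral_simple_pair: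
  fixes f :: "'t \<Rightarrow> 'y \<Rightarrow> ennreal"
  assumes T: "simple_function M T" and Y: "simple_function M Y"
  shows "(\<integral>\<^sup>+ \<omega>. f (T \<omega>) (Y \<omega>) \<partial>M) =
    (\<Sum>(y, t)\<in>(\<lambda>\<omega>. (Y \<omega>, T \<omega>)) ` space M. f t y * ennreal \<P>(\<omega> in M. Y \<omega> = y \<and> T \<omega> = t))"
proof -
  have YT: "simple_function M (\<lambda>\<omega>. (Y \<omega>, T \<omega>))"
    using Y T by (rule simple_function_Pair)
  have f: "simple_function M (\<lambda>\<omega>. f (T \<omega>) (Y \<omega>))"
    using T Y by (rule simple_function_compose2)
  have "(\<integral>\<^sup>+ \<omega>. f (T \<omega>) (Y \<omega>) \<partial>M) =
      (\<Sum>w\<in>(\<lambda>\<omega>. (Y \<omega>, T \<omega>)) ` space M.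
        f (snd w) (fst w) * emeasure M {\<omega> \<in> space M. (Y \<omega>, T \<omega>) = w})"
    unfolding nn_integral_eq_simple_integral[OF f]
    by (rule simple_function_partition[OF f YT]) auto
  then show ?thesis
    by (auto simp: emeasure_eq_measure case_prod_beta prod_eq_iff intro!: sum.cong)
qed

text \<open>Strict inequality occurs when \<open>q\<close> charges pairs of probability zero.\<close>

lemma nn_integral_likelihood_ratio_le_1:
  fixes Y :: "'a \<Rightarrow> 'y::finite"
  assumes T: "simple_function M T" and Y: "simple_function M Y"
  shows "(\<integral>\<^sup>+ \<omega>. ennreal (pmf (q (T \<omega>)) (Y \<omega>) / pmf (bayes_predictor M T Y (T \<omega>)) (Y \<omega>)) \<partial>M) \<le> 1"
proof -
  define S where "S = (\<lambda>\<omega>. (Y \<omega>, T \<omega>)) ` space M"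
  define P where "P = (\<lambda>t. \<P>(\<omega> in M. T \<omega> = t))"
  define J where "J = (\<lambda>y t. \<P>(\<omega> in M. Y \<omega> = y \<and> T \<omega> = t))"
  have fin: "finite (T ` space M)" "finite S"
    using simple_functionD(1)[OF T] simple_functionD(1)[OF simple_function_Pair[OF Y T]]
    by (auto simp: S_def)
  have J_le: "J y t \<le> P t" for y t
    unfolding J_def P_def using sets_simple_function_eq[OF T, of t]
    by (intro finite_measure_mono) auto
  \<comment> \<open>For \<open>J y t > 0\<close> the Bayes predictor is \<open>J y t / P t\<close>
    and both sides agree; for \<open>J y t = 0\<close> the left side is 0.\<close>
  have le: "pmf (q t) y / pmf (bayes_predictor M T Y t) y * J y t \<le> P t * pmf (q t) y" for y t
  proof (cases "J y t = 0")
    case False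
    then have "J y t > 0" by (simp add: J_def less_le)
    with J_le[of y t] have "P t > 0" by linarith
    then have "pmf (bayes_predictor M T Y t) y = J y t / P t"
      using pmf_bayes_predictor[OF T Y, of t y] by (simp add: cond_prob_def P_def J_def)
    with \<open>J y t > 0\<close> \<open>P t > 0\<close> show ?thesis
      by simp
  qed (simp add: P_def)
  have "(\<integral>\<^sup>+ \<omega>. ennreal (pmf (q (T \<omega>)) (Y \<omega>) / pmf (bayes_predictor M T Y (T \<omega>)) (Y \<omega>)) \<partial>M) =
      (\<Sum>(y, t)\<in>S. ennreal (pmf (q t) y / pmf (bayes_predictor M T Y t) y * J y t))"
    unfolding nn_integral_simple_pair[OF T Y,
        of "\<lambda>t y. ennreal (pmf (q t) y / pmf (bayes_predictor M T Y t) y)"]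
    by (auto simp: S_def J_def simp flip: ennreal_mult'' intro!: sum.cong)
  also have "\<dots> \<le> (\<Sum>(y, t)\<in>S. ennreal (P t * pmf (q t) y))"
    using le by (intro sum_mono) (auto intro!: ennreal_leI)
  \<comment> \<open>Passing from the attained pairs to the full product lets the masses of each
    \<open>q t\<close> sum to 1.\<close>
  also have "\<dots> \<le> (\<Sum>(y, t)\<in>UNIV \<times> T ` space M. ennreal (P t * pmf (q t) y))"
    using fin by (intro sum_mono2) (auto simp: S_def)
  also have "\<dots> = ennreal (\<Sum>(y, t)\<in>UNIV \<times> T ` space M. P t * pmf (q t) y)"
    by (subst sum_ennreal[symmetric]) (auto simp: P_def case_prod_beta)
  also have "(\<Sum>(y, t)\<in>UNIV \<times> T ` space M. P t * pmf (q t) y) =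
      (\<Sum>t\<in>T ` space M. \<Sum>y\<in>UNIV. P t * pmf (q t) y)"
    by (subst sum.swap) (simp add: sum.cartesian_product)
  also have "\<dots> = (\<Sum>t\<in>T ` space M. P t)"
    by (simp add: sum_pmf_eq_1 flip: sum_distrib_left)
  also have "\<dots> = prob (\<Union>t\<in>T ` space M. {\<omega> \<in> space M. T \<omega> = t})"
    unfolding P_def using fin sets_simple_function_eq[OF T]
    by (intro finite_measure_finite_Union[symmetric]) (auto simp: disjoint_family_on_def)
  also have "(\<Union>t\<in>T ` space M. {\<omega> \<in> space M. T \<omega> = t}) = space M"
    by auto
  finally show ?thesis
    by (simp add: prob_space)
qed

end

section \<open>Gibbs' inequality and conditional entropy\<close>

context information_space
begin

text \<open>The pointwise form of Gibbs' inequality: \<open>ln u \<le> u - 1\<close> at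
  \<open>u = q / p\<close>, divided by \<open>ln b\<close>. The constant \<open>1 / ln b\<close>
  stands on the left to avoid subtraction in \<open>ennreal\<close>. For \<open>q = 0\<close> the
  right side is infinite.\<close>

lemma neg_log_add_le:
  assumes "0 < p" "p \<le> 1" "0 \<le> q" "q \<le> 1"
  shows "neg_log b p + ennreal (1 / ln b) \<le> neg_log b q + ennreal (1 / ln b) * ennreal (q / p)"
proof (cases "q = 0")
  case False
  then have "q > 0" using assms by simp
  have lnb: "ln b > 0" using b_gt_1 by simp
  have "ln (q / p) \<le> q / p - 1"
    using \<open>q > 0\<close> assms by (intro ln_le_minus_one) simp
  then have "ln q - ln p \<le> q / p - 1"
    using \<open>q > 0\<close> assms by (simp add: ln_div)
  then have "(1 - ln p) / ln b \<le> (q / p - ln q) / ln b"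
    using lnb by (intro divide_right_mono) auto
  then have "- log b p + 1 / ln b \<le> - log b q + 1 / ln b * (q / p)"
    by (simp add: log_def diff_divide_distrib mult.commute)
  moreover have "log b p \<le> 0" "log b q \<le> 0"
    using assms \<open>q > 0\<close> b_gt_1 by simp_all
  ultimately show ?thesis
    using assms False lnb
    by (simp add: neg_log_def ennreal_leI flip: ennreal_plus ennreal_mult')
qed (simp add: neg_log_def)

text \<open>Integrate \<open>neg_log_add_le\<close>. The expected likelihood ratio is at most 1, so
  the same constant \<open>k\<close> remains on both sides; being finite, it cancels even if the
  cross entropy of \<open>q\<close> is infinite.\<close>

lemma cross_entropy_bayes_predictor_le:
  fixes Y :: "'a \<Rightarrow> 'y::finite"
  assumes T: "simple_function M T" and Y: "simple_function M Y"
  shows "cross_entropy M b T Y (bayes_predictor M T Y) \<le> cross_entropy M b T Y q"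
proof -
  define p where "p = bayes_predictor M T Y"
  define k where "k = ennreal (1 / ln b)"
  \<comment> \<open>Every function of two simple functions is simple, hence measurable, whatever
    \<open>q\<close> is.\<close>
  have meas: "(\<lambda>\<omega>. f (T \<omega>) (Y \<omega>)) \<in> borel_measurable M" for f :: "_ \<Rightarrow> _ \<Rightarrow> ennreal"
    using simple_function_compose2[OF T Y] by (rule borel_measurable_simple_function)
  \<comment> \<open>Almost surely both the observed value of \<open>T\<close> and the observed pair
    have positive probability, and the predictor is the quotient of these.\<close>
  have "AE \<omega> in M. pmf (p (T \<omega>)) (Y \<omega>) > 0"
    using AE_simple_function_prob_nonzero[OF T]
      AE_simple_function_prob_nonzero[OF simple_function_Pair[OF Y T]]
    by eventually_elim
       (auto simp: p_def pmf_bayes_predictor[OF T Y] cond_prob_def zero_less_measure_iff)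
  then have "AE \<omega> in M. neg_log b (pmf (p (T \<omega>)) (Y \<omega>)) + k \<le>
      neg_log b (pmf (q (T \<omega>)) (Y \<omega>)) + k * ennreal (pmf (q (T \<omega>)) (Y \<omega>) / pmf (p (T \<omega>)) (Y \<omega>))"
    by eventually_elim (auto simp: k_def pmf_le_1 intro!: neg_log_add_le)
  then have "(\<integral>\<^sup>+ \<omega>. neg_log b (pmf (p (T \<omega>)) (Y \<omega>)) + k \<partial>M) \<le>
      (\<integral>\<^sup>+ \<omega>. neg_log b (pmf (q (T \<omega>)) (Y \<omega>)) +
        k * ennreal (pmf (q (T \<omega>)) (Y \<omega>) / pmf (p (T \<omega>)) (Y \<omega>)) \<partial>M)"
    by (rule nn_integral_mono_AE)
  then have "cross_entropy M b T Y p + k \<le> cross_entropy M b T Y q +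
      k * (\<integral>\<^sup>+ \<omega>. ennreal (pmf (q (T \<omega>)) (Y \<omega>) / pmf (p (T \<omega>)) (Y \<omega>)) \<partial>M)"
    using meas[of "\<lambda>t y. neg_log b (pmf (p t) y)"] meas[of "\<lambda>t y. neg_log b (pmf (q t) y)"]
      meas[of "\<lambda>t y. ennreal (pmf (q t) y / pmf (p t) y)"]
    by (simp add: cross_entropy_def nn_integral_add nn_integral_cmult emeasure_space_1)
  also have "\<dots> \<le> cross_entropy M b T Y q + k * 1"
    unfolding p_def by (intro add_left_mono mult_left_mono nn_integral_likelihood_ratio_le_1 T Y) simp
  finally show ?thesis
    by (simp add: p_def k_def add.commute[of _ "ennreal (1 / ln b)"] ennreal_add_left_cancel_le)
qed

text \<open>Both quantities are the same finite sum over attained pairs. Nonnegativity, which comes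
  from joint probabilities being at most marginal ones, ensures that \<open>ennreal\<close> does not
  truncate.\<close>

lemma cross_entropy_bayes_predictor:
  fixes Y :: "'a \<Rightarrow> 'y::finite"
  assumes T: "simple_function M T" and Y: "simple_function M Y"
  shows "cross_entropy M b T Y (bayes_predictor M T Y) = ennreal (cond_entropy M b Y T)"
    and "cond_entropy M b Y T \<ge> 0"
proof -
  define S where "S = (\<lambda>\<omega>. (Y \<omega>, T \<omega>)) ` space M"
  define P where "P = (\<lambda>t. \<P>(\<omega> in M. T \<omega> = t))"
  define J where "J = (\<lambda>w. \<P>(\<omega> in M. Y \<omega> = fst w \<and> T \<omega> = snd w))"
  have YT: "simple_function M (\<lambda>\<omega>. (Y \<omega>, T \<omega>))"
    using Y T by (rule simple_function_Pair)
  have dT: "simple_distributed M T P"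
    by (rule simple_distributedI[OF T]) (auto simp: P_def vimage_def Int_def conj_commute)
  have dYT: "simple_distributed M (\<lambda>\<omega>. (Y \<omega>, T \<omega>)) J"
    by (rule simple_distributedI[OF YT])
       (auto simp: J_def vimage_def Int_def conj_commute intro!: arg_cong[where f = prob])
  have H: "cond_entropy M b Y T = (\<Sum>(y, t)\<in>S. - log b (J (y, t) / P t) * J (y, t))"
    unfolding conditional_entropy_eq[OF dT dYT]
    by (simp add: S_def sum_negf[symmetric] case_prod_beta mult.commute)
  have J_le: "J (y, t) \<le> P t" for y t
    unfolding J_def P_def using sets_simple_function_eq[OF T, of t]
    by (intro finite_measure_mono) auto
  have nonneg: "- log b (J (y, t) / P t) * J (y, t) \<ge> 0" for y t
  proof (cases "J (y, t) = 0")
    case False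
    then have "J (y, t) > 0" by (simp add: J_def less_le)
    moreover from this J_le[of y t] have "P t > 0" by linarith
    ultimately show ?thesis
      using J_le[of y t] b_gt_1 by (auto simp: mult_le_0_iff)
  qed simp
  then show "cond_entropy M b Y T \<ge> 0"
    unfolding H by (auto intro!: sum_nonneg)
  \<comment> \<open>An attained pair may have probability zero. Then \<open>neg_log\<close> may be
    infinite, but its product with 0 is 0 in \<open>ennreal\<close>, as is the right side.\<close>
  have eq: "neg_log b (pmf (bayes_predictor M T Y t) y) * ennreal (J (y, t)) =
      ennreal (- log b (J (y, t) / P t) * J (y, t))" for y t
  proof (cases "J (y, t) = 0")
    case False
    then have "J (y, t) > 0" by (simp add: J_def less_le)
    moreover from this J_le[of y t] have "P t > 0" by linarith
    moreover from this have "pmf (bayes_predictor M T Y t) y = J (y, t) / P t"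
      using pmf_bayes_predictor[OF T Y, of t y] by (simp add: cond_prob_def P_def J_def)
    ultimately show ?thesis
      by (simp add: neg_log_def flip: ennreal_mult'')
  qed simp
  show "cross_entropy M b T Y (bayes_predictor M T Y) = ennreal (cond_entropy M b Y T)"
    unfolding cross_entropy_def H
      nn_integral_simple_pair[OF T Y, of "\<lambda>t y. neg_log b (pmf (bayes_predictor M T Y t) y)"]
    using eq nonneg
    by (subst sum_ennreal[symmetric]) (auto simp: S_def J_def case_prod_beta intro!: sum.cong)
qed

lemma INF_cross_entropy:
  fixes Y :: "'a \<Rightarrow> 'y::finite"
  assumes "simple_function M T" and "simple_function M Y"
  shows "(INF q. cross_entropy M b T Y q) = cross_entropy M b T Y (bayes_predictor M T Y)"
  using cross_entropy_bayes_predictor_le[OF assms]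
  by (intro antisym INF_greatest INF_lower) auto

lemma min_cross_entropy_eq_cond_entropy:
  fixes Y :: "'a \<Rightarrow> 'y::finite"
  assumes "simple_function M T" and "simple_function M Y"
  shows "min_cross_entropy M b T Y = cond_entropy M b Y T"
  unfolding min_cross_entropy_def INF_cross_entropy[OF assms] cross_entropy_bayes_predictor(1)[OF assms]
  by (rule enn2real_ennreal[OF cross_entropy_bayes_predictor(2)[OF assms]])

section \<open>Comparison of different observations\<close>

text \<open>A predictor \<open>q\<close> that sees only \<open>f (T \<omega>)\<close> is imitated by
  \<open>q \<circ> f\<close>, which sees \<open>T \<omega>\<close>, at equal cross entropy.\<close>

lemma min_cross_entropy_le_comp:
  fixes Y :: "'a \<Rightarrow> 'y::finite"
  shows "min_cross_entropy M b T Y \<le> min_cross_entropy M b (\<lambda>\<omega>. f (T \<omega>)) Y"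
  unfolding min_cross_entropy_def
proof (rule enn2real_mono)
  show "(INF q. cross_entropy M b T Y q) \<le> (INF q. cross_entropy M b (\<lambda>\<omega>. f (T \<omega>)) Y q)"
  proof (rule INF_greatest)
    fix q
    have "cross_entropy M b (\<lambda>\<omega>. f (T \<omega>)) Y q = cross_entropy M b T Y (q \<circ> f)"
      by (simp add: cross_entropy_def)
    then show "(INF q. cross_entropy M b T Y q) \<le> cross_entropy M b (\<lambda>\<omega>. f (T \<omega>)) Y q"
      by (auto intro: INF_lower)
  qed
\<comment> \<open>\<open>enn2real\<close> sends infinity to 0, so its monotonicity requires a finite
  upper bound.\<close>
qed (use min_cross_entropy_finite[OF prob_space_axioms] in auto)

text \<open>This is how sufficiency enters. Almost surely neither Bayes predictor is at its default,
  so both are given by the conditional probabilities and incur the same loss at almost every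
  outcome.\<close>

lemma min_cross_entropy_cong_cond_prob:
  fixes Y :: "'a \<Rightarrow> 'y::finite"
  assumes S: "simple_function M S" and T: "simple_function M T" and Y: "simple_function M Y"
    and eq: "AE \<omega> in M. \<forall>y. \<P>(\<omega>' in M. Y \<omega>' = y \<bar> S \<omega>' = S \<omega>) = \<P>(\<omega>' in M. Y \<omega>' = y \<bar> T \<omega>' = T \<omega>)"
  shows "min_cross_entropy M b S Y = min_cross_entropy M b T Y"
proof -
  have "AE \<omega> in M. neg_log b (pmf (bayes_predictor M S Y (S \<omega>)) (Y \<omega>)) =
      neg_log b (pmf (bayes_predictor M T Y (T \<omega>)) (Y \<omega>))"
    using eq AE_simple_function_prob_nonzero[OF S] AE_simple_function_prob_nonzero[OF T]
    by eventually_elim (simp add: pmf_bayes_predictor[OF S Y] pmf_bayes_predictor[OF T Y])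
  then have "cross_entropy M b S Y (bayes_predictor M S Y) = cross_entropy M b T Y (bayes_predictor M T Y)"
    unfolding cross_entropy_def by (rule nn_integral_cong_AE)
  then show ?thesis
    by (simp add: min_cross_entropy_def INF_cross_entropy S T Y)
qed

end

section \<open>Sparsity and continuity losses\<close>

lemma sparsity_loss_nonneg: "sparsity_loss M L X s z \<ge> 0"
  by (simp add: sparsity_loss_def)

lemma continuity_loss_nonneg: "continuity_loss M L X c z \<ge> 0"
  by (auto simp: continuity_loss_def intro!: integral_nonneg_AE sum_nonneg)

lemma sparsity_loss_eq_0:
  assumes "AE \<omega> in M. (\<Sum>i=1..L. z (X \<omega>) i) \<le> s"
  shows "sparsity_loss M L X s z = 0"
  unfolding sparsity_loss_def
  by (rule integral_eq_zero_AE) (use assms in eventually_elim, auto)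

text \<open>The hypothesis bounds the total of the jumps, whereas the loss penalizes each jump
  separately; a single jump is at most the total.\<close>

lemma continuity_loss_eq_0:
  assumes "AE \<omega> in M. (\<Sum>i=2..L. \<bar>z (X \<omega>) i - z (X \<omega>) (i - 1)\<bar>) \<le> c"
  shows "continuity_loss M L X c z = 0"
  unfolding continuity_loss_def
proof (rule integral_eq_zero_AE, use assms in eventually_elim)
  fix \<omega>
  assume le: "(\<Sum>i=2..L. \<bar>z (X \<omega>) i - z (X \<omega>) (i - 1)\<bar>) \<le> c"
  have "\<bar>z (X \<omega>) i - z (X \<omega>) (i - 1)\<bar> \<le> c" if "i \<in> {2..L}" for i
    using member_le_sum[OF that, of "\<lambda>i. \<bar>z (X \<omega>) i - z (X \<omega>) (i - 1)\<bar>"] le by simp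
  then show "(\<Sum>i=2..L. max (\<bar>z (X \<omega>) i - z (X \<omega>) (i - 1)\<bar> - c) 0) = 0"
    by (intro sum.neutral) auto
qed

section \<open>Global minimality of the generator objective\<close>

theorem theorem1:
  fixes M :: "'w measure" and b :: real and L :: nat
    and X :: "'w \<Rightarrow> (nat \<Rightarrow> 'v::euclidean_space)" and Y :: "'w \<Rightarrow> 'y::finite"
    and h s c lg ls lc :: real
    and z :: "(nat \<Rightarrow> 'v) \<Rightarrow> (nat \<Rightarrow> real)"
    and R Rc :: "'w \<Rightarrow> (nat \<Rightarrow> 'v)" and Z :: "'w \<Rightarrow> nat \<Rightarrow> real"
  assumes "prob_space M" and "b > 1"
    and "simple_function M X" and "X \<in> space M \<rightarrow> texts L" and "simple_function M Y"
    and "lg \<ge> 0" and "ls \<ge> 0" and "lc \<ge> 0"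
    and "z \<in> schemes L"
  defines "R \<equiv> \<lambda>\<omega>. rationale L z (X \<omega>)"
    and "Rc \<equiv> \<lambda>\<omega>. complement_rationale L z (X \<omega>)"
    and "Z \<equiv> \<lambda>\<omega>. z (X \<omega>)"
  assumes sufficiency:
      "AE \<omega> in M. \<forall>y. \<P>(\<omega>' in M. Y \<omega>' = y \<bar> R \<omega>' = R \<omega>) = \<P>(\<omega>' in M. Y \<omega>' = y \<bar> X \<omega>' = X \<omega>)"
    and comprehensiveness: "cond_entropy M b Y Rc \<ge> cond_entropy M b Y R + h"
    and compactness:
      "AE \<omega> in M. (\<Sum>i=1..L. Z \<omega> i) \<le> s \<and> (\<Sum>i=2..L. \<bar>Z \<omega> i - Z \<omega> (i - 1)\<bar>) \<le> c"
  shows "\<forall>z' \<in> schemes L. generator_objective M b L X Y h s c lg ls lc z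
                          \<le> generator_objective M b L X Y h s c lg ls lc z'"
proof -
  interpret prob_space M by fact
  interpret information_space M b by unfold_locales fact
  note X = \<open>simple_function M X\<close> and Y = \<open>simple_function M Y\<close>
  have R: "simple_function M R" and Rc: "simple_function M Rc"
    unfolding R_def Rc_def by (rule simple_function_compose1[OF X])+
  have "predictor_loss M b L X Y z = cond_entropy M b Y R"
    unfolding predictor_loss_def R_def[symmetric] by (rule min_cross_entropy_eq_cond_entropy[OF R Y])
  moreover have "complement_loss M b L X Y z = cond_entropy M b Y Rc"
    unfolding complement_loss_def Rc_def[symmetric] by (rule min_cross_entropy_eq_cond_entropy[OF Rc Y])
  \<comment> \<open>With both losses identified as conditional entropies, comprehensiveness says
    that the first argument of \<open>max\<close> is at most 0.\<close>
  ultimately have gap: "gap_loss M b L X Y h z = 0"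
    using comprehensiveness by (simp add: gap_loss_def)
  have sparsity: "sparsity_loss M L X s z = 0"
    using compactness unfolding Z_def by (intro sparsity_loss_eq_0) auto
  have continuity: "continuity_loss M L X c z = 0"
    using compactness unfolding Z_def by (intro continuity_loss_eq_0) auto
  have predictor: "predictor_loss M b L X Y z = min_cross_entropy M b X Y"
    unfolding predictor_loss_def R_def[symmetric]
    by (rule min_cross_entropy_cong_cond_prob[OF R X Y sufficiency])
  show ?thesis
  proof
    fix z' :: "(nat \<Rightarrow> 'v) \<Rightarrow> nat \<Rightarrow> real"
    \<comment> \<open>The map \<open>f\<close> is \<open>rationale L z'\<close>. The loss of
      \<open>z\<close> is rewritten first to that of observing all of \<open>X\<close>; only then is
      the definition opened for \<open>z'\<close>.\<close>
    have "predictor_loss M b L X Y z \<le> predictor_loss M b L X Y z'"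
      unfolding predictor unfolding predictor_loss_def by (rule min_cross_entropy_le_comp)
    moreover have "0 \<le> lg * gap_loss M b L X Y h z'"
      using \<open>lg \<ge> 0\<close> by (simp add: gap_loss_def)
    moreover have "0 \<le> ls * sparsity_loss M L X s z'" "0 \<le> lc * continuity_loss M L X c z'"
      using \<open>ls \<ge> 0\<close> \<open>lc \<ge> 0\<close> by (simp_all add: sparsity_loss_nonneg continuity_loss_nonneg)
    ultimately show "generator_objective M b L X Y h s c lg ls lc z
        \<le> generator_objective M b L X Y h s c lg ls lc z'"
      by (simp add: generator_objective_def gap sparsity continuity)
  qed
qed

end
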